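(* Let $a,b,c,d>0$ with $ad>bc$, and let $\{W_n(z)\}_{n\ge0}$ be defined by $W_0(z)=1$, $W_1(z)=z$, $W_n(z)=(az+b)W_{n-1}(z)+(cz+d)W_{n-2}(z)$ for $n\ge2$. Let $\Delta_\Delta=-a^2d+abc+c^2$, $x_\Delta^{+}=\frac{-ab-2c+2\sqrt{\Delta_\Delta}}{a^2}$, $h(z)=(2-a)z-b$, and suppose that $h(x_\Delta^+)$ is a positive real number. Let $n^+=-(ax_\Delta^++b)/h(x_\Delta^+)$. Then for every integer $n\ge n^+$, the polynomial $W_n(z)$ has at least two distinct real zeros. *)

theory Defs
  imports Complex_Main "HOL-Computational_Algebra.Polynomial"
begin

fun W :: "real \<Rightarrow> real \<Rightarrow> real \<Rightarrow> real \<Rightarrow> nat \<Rightarrow> real poly" where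
  "W a b c d 0 = 1"
| "W a b c d (Suc 0) = [:0, 1:]"
| "W a b c d (Suc (Suc n)) = [:b, a:] * W a b c d (Suc n) + [:d, c:] * W a b c d n"

text \<open>The discriminant of the quadratic \<open>(a z + b)\<^sup>2 + 4 (c z + d)\<close> is 16 times the following
  quantity; \<open>x_Delta_plus\<close> below is a zero of this quadratic.\<close>

definition Delta_Delta :: "real \<Rightarrow> real \<Rightarrow> real \<Rightarrow> real \<Rightarrow> real" where
  "Delta_Delta a b c d = - (a\<^sup>2 * d) + a * b * c + c\<^sup>2"

text \<open>\<open>Delta_Delta\<close> may be negative, so the square root has to be taken in the complex numbers.
  The real function \<open>sqrt\<close> would not do: it sends a negative \<open>t\<close> to \<open>- sqrt (- t)\<close>.
  For nonnegative arguments the principal root \<open>csqrt\<close> is the usual nonnegative real root.\<close>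

definition x_Delta_plus :: "real \<Rightarrow> real \<Rightarrow> real \<Rightarrow> real \<Rightarrow> complex" where
  "x_Delta_plus a b c d =
     (- (of_real a * of_real b) - 2 * of_real c + 2 * csqrt (of_real (Delta_Delta a b c d)))
       / (of_real a)\<^sup>2"

definition h :: "real \<Rightarrow> real \<Rightarrow> complex \<Rightarrow> complex" where
  "h a b z = (2 - of_real a) * z - of_real b"

text \<open>If \<open>h a b (x_Delta_plus a b c d)\<close> is a positive real, then \<open>a \<noteq> 2\<close> (as \<open>b > 0\<close>), so
  \<open>x_Delta_plus a b c d\<close> and the following quotient are real.\<close>

definition n_plus :: "real \<Rightarrow> real \<Rightarrow> real \<Rightarrow> real \<Rightarrow> complex" where
  "n_plus a b c d =
     - (of_real a * x_Delta_plus a b c d + of_real b) / h a b (x_Delta_plus a b c d)"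

end

theory Submission
  imports Defs
begin

text \<open>Write \<open>A = a z + b\<close>, \<open>B = c z + d\<close> and let \<open>x\<close> be the larger zero of \<open>A\<^sup>2 + 4 B\<close>. At \<open>x\<close> the
  characteristic polynomial of the recurrence has the double root \<open>\<alpha> = A / 2 < 0\<close>, so that
  \<open>W\<^sub>n(x) = \<alpha>\<^sup>n\<^sup>-\<^sup>1 (A + n h(x)) / 2\<close>. Consider the sign of \<open>(-1)\<^sup>n W\<^sub>n\<close>. It is positive near
  \<open>-\<infinity>\<close>, and also at \<open>-d/c > x\<close>, where \<open>B = 0\<close> and \<open>W\<^sub>n = A\<^sup>n\<^sup>-\<^sup>1 z\<close>. If \<open>n > n\<^sup>+\<close> it is negative at
  \<open>x\<close>, giving a zero on each side. If \<open>n = n\<^sup>+\<close> then \<open>x\<close> is a zero at which the derivative of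
  \<open>(-1)\<^sup>n W\<^sub>n\<close> turns out to be positive, so there is a further zero to the left of \<open>x\<close>.\<close>

text \<open>The hypotheses turn t^2 - A t - B into (t - \<alpha>)^2, hence the factor affine in
  \<open>n\<close>. The extra \<open>\<alpha>\<close> on the left avoids the exponent n - 1.\<close>

lemma poly_W_double_root:
  fixes a b c d x \<alpha> :: real
  assumes A: "a * x + b = 2 * \<alpha>" and B: "c * x + d = - \<alpha>\<^sup>2"
  shows "\<alpha> * poly (W a b c d n) x = \<alpha> ^ n * (\<alpha> + real n * (x - \<alpha>))"
proof (induction n rule: induct_nat_012)
  case (ge2 n)
  have "\<alpha> * poly (W a b c d (Suc (Suc n))) x
      = (a * x + b) * (\<alpha> * poly (W a b c d (Suc n)) x) + (c * x + d) * (\<alpha> * poly (W a b c d n) x)"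
    by (simp add: algebra_simps)
  also have "\<dots> = \<alpha> ^ Suc (Suc n) * (\<alpha> + real (Suc (Suc n)) * (x - \<alpha>))"
    unfolding A B ge2 by (simp add: algebra_simps power2_eq_square)
  finally show ?case .
qed auto

text \<open>The factor \<open>\<alpha>\<^sup>3\<close> avoids negative exponents. The formula is the derivative at \<open>x\<close> of the
  expansion of \<open>W\<^sub>n\<close> in powers of \<open>A\<^sup>2 + 4 B\<close>, whose own derivative there is \<open>4 (a \<alpha> + c)\<close>.\<close>

lemma poly_pderiv_W_double_root:
  fixes a b c d x \<alpha> :: real
  assumes A: "a * x + b = 2 * \<alpha>" and B: "c * x + d = - \<alpha>\<^sup>2"
  shows "\<alpha> ^ 3 * poly (pderiv (W a b c d n)) x =
    \<alpha> ^ n * (real n * \<alpha>\<^sup>2 + real n * (real n - 1) / 2 * \<alpha> * (a * \<alpha> + c)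
      + (x - \<alpha>) * (real n * (real n - 1) / 2 * \<alpha> * a
          + real n * (real n - 1) * (real n - 2) / 6 * (a * \<alpha> + c)))"
    (is "_ = \<alpha> ^ n * ?f (real n)")
proof (induction n rule: induct_nat_012)
  case 1
  show ?case by (simp add: pderiv_pCons power3_eq_cube power2_eq_square)
next
  case (ge2 n)
  \<comment> \<open>With \<open>P\<close> for the power of \<open>\<alpha>\<close> and the brackets
    kept opaque, the power is factored out first; what remains is a polynomial identity in
    \<open>n\<close>.\<close>
  have factor: "2 * \<alpha> * (\<alpha> * P * f1) + (- \<alpha>\<^sup>2) * (P * f0) + \<alpha>\<^sup>2 * (a * (\<alpha> * P * g1) + c * (P * g0))
      = \<alpha> * (\<alpha> * P) * (2 * f1 - f0 + a * \<alpha> * g1 + c * g0)" for P f0 f1 g0 g1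
    by (simp add: algebra_simps power2_eq_square)
  have "\<alpha> ^ 3 * poly (pderiv (W a b c d (Suc (Suc n)))) x
      = (a * x + b) * (\<alpha> ^ 3 * poly (pderiv (W a b c d (Suc n))) x)
        + (c * x + d) * (\<alpha> ^ 3 * poly (pderiv (W a b c d n)) x)
        + \<alpha>\<^sup>2 * (a * (\<alpha> * poly (W a b c d (Suc n)) x) + c * (\<alpha> * poly (W a b c d n) x))"
    by (simp add: pderiv_mult pderiv_add pderiv_smult pderiv_pCons algebra_simps power2_eq_square power3_eq_cube)
  also have "\<dots> = 2 * \<alpha> * (\<alpha> ^ Suc n * ?f (real (Suc n))) + (- \<alpha>\<^sup>2) * (\<alpha> ^ n * ?f (real n))
        + \<alpha>\<^sup>2 * (a * (\<alpha> ^ Suc n * (\<alpha> + real (Suc n) * (x - \<alpha>)))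
               + c * (\<alpha> ^ n * (\<alpha> + real n * (x - \<alpha>))))"
    unfolding A B ge2 poly_W_double_root[OF A B] ..
  also have "\<dots> = \<alpha> ^ Suc (Suc n) * (2 * ?f (real (Suc n)) - ?f (real n)
        + a * \<alpha> * (\<alpha> + real (Suc n) * (x - \<alpha>)) + c * (\<alpha> + real n * (x - \<alpha>)))"
    unfolding power_Suc by (rule factor)
  also have "2 * ?f (real (Suc n)) - ?f (real n)
        + a * \<alpha> * (\<alpha> + real (Suc n) * (x - \<alpha>)) + c * (\<alpha> + real n * (x - \<alpha>))
      = ?f (real (Suc (Suc n)))"
    by (simp add: field_simps power2_eq_square)
  finally show ?case .
qed auto

lemma poly_W_at_root_of_second_coeff:
  fixes a b c d x :: real
  assumes "c * x + d = 0"
  shows "poly (W a b c d (Suc n)) x = (a * x + b) ^ n * x"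
proof (induction n)
  case (Suc n)
  have "poly (W a b c d (Suc (Suc n))) x
      = (a * x + b) * poly (W a b c d (Suc n)) x + (c * x + d) * poly (W a b c d n) x"
    by (simp add: algebra_simps)
  then show ?case using Suc assms by simp
qed simp

text \<open>For \<open>z\<close> far to the left the recurrence preserves
  \<open>?V (Suc m) \<ge> K * ?V m > 0\<close>: half of - a z \<open>?V (Suc m)\<close> absorbs the
  negative term c z \<open>?V m\<close>, the other half outweighs \<open>b\<close> and
  \<open>K\<close>.\<close>

lemma poly_W_sign_left:
  fixes a b c d x :: real
  assumes "a > 0" "b > 0" "c > 0" "d > 0"
  shows "\<exists>z < x. (-1) ^ n * poly (W a b c d n) z > 0"
proof -
  \<comment> \<open>Chosen so that c z / K = a z / 2.\<close>
  define K where "K = 2 * c / a"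
  have K: "K > 0" using assms by (simp add: K_def)
  \<comment> \<open>The bound \<open>- K\<close> starts the induction; the last one yields
    \<open>- (a * z / 2) - b \<ge> K\<close>.\<close>
  define z where "z = min (x - 1) (min (- K) (- (2 * (K + b) / a)))"
  have z: "z < x" "z \<le> - K" "z \<le> - (2 * (K + b) / a)"
    unfolding z_def by linarith+
  have "a * z \<le> a * (- (2 * (K + b) / a))"
    using z(3) assms by (intro mult_left_mono) auto
  then have az: "a * z \<le> - (2 * (K + b))" using assms by simp
  have drop_d: "(- (a * z / 2) - b) * v \<le> - (a * z + b) * v + c * z * u + d * u"
    if "a * z / 2 * v \<le> c * z * u" "u > 0" for u v
    using that mult_pos_pos[OF \<open>d > 0\<close> \<open>u > 0\<close>] by (simp add: algebra_simps)
  let ?V = "\<lambda>m. (-1) ^ m * poly (W a b c d m) z"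
  have "?V m > 0 \<and> ?V (Suc m) \<ge> K * ?V m" for m
  proof (induction m)
    case 0
    then show ?case using z by simp
  next
    case (Suc m)
    have pos: "?V (Suc m) > 0" using Suc K by (meson less_le_trans mult_pos_pos)
    have rec: "?V (Suc (Suc m)) = - (a * z + b) * ?V (Suc m) + (c * z) * ?V m + d * ?V m"
      by (simp add: algebra_simps)
    have cz: "c * z \<le> 0" using assms z K by (simp add: mult_le_0_iff)
    have "?V m \<le> ?V (Suc m) / K" using Suc K by (simp add: field_simps)
    then have "(c * z) * ?V m \<ge> (c * z) * (?V (Suc m) / K)"
      using cz by (intro mult_left_mono_neg) auto
    also have "(c * z) * (?V (Suc m) / K) = (a * z / 2) * ?V (Suc m)"
      using assms by (simp add: K_def field_simps)
    finally have "?V (Suc (Suc m)) \<ge> (- (a * z / 2) - b) * ?V (Suc m)"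
      unfolding rec using Suc by (intro drop_d) auto
    moreover have "(- (a * z / 2) - b) * ?V (Suc m) \<ge> K * ?V (Suc m)"
      using pos az by (intro mult_right_mono) auto
    ultimately show ?case using pos by linarith
  qed
  then show ?thesis using z(1) by blast
qed

text \<open>An affine map with real coefficients and nonzero slope takes real values only at real
  points, whereas a negative \<open>Delta_Delta\<close> would give \<open>x_Delta_plus\<close> a
  nonzero imaginary part.\<close>

lemma x_Delta_plus_real:
  assumes "a > 0" "b > 0"
    and "h a b (x_Delta_plus a b c d) \<in> \<real>" "Re (h a b (x_Delta_plus a b c d)) > 0"
  shows "Delta_Delta a b c d \<ge> 0"
    and "x_Delta_plus a b c d =
      of_real ((- (a * b) - 2 * c + 2 * sqrt (Delta_Delta a b c d)) / a\<^sup>2)"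
proof -
  have "a \<noteq> 2" using assms by (auto simp: h_def)
  then have Im0: "Im (x_Delta_plus a b c d) = 0"
    using assms(3) by (auto simp: h_def complex_is_Real_iff)
  show D: "Delta_Delta a b c d \<ge> 0"
  proof (rule ccontr)
    assume neg: "\<not> ?thesis"
    have "Im (x_Delta_plus a b c d) = 2 * sqrt (- Delta_Delta a b c d) / a\<^sup>2"
      unfolding x_Delta_plus_def using neg
      by (simp add: csqrt_of_real_nonpos flip: of_real_power)
    then show False using Im0 neg assms by simp
  qed
  show "x_Delta_plus a b c d =
      of_real ((- (a * b) - 2 * c + 2 * sqrt (Delta_Delta a b c d)) / a\<^sup>2)"
    using D by (simp add: x_Delta_plus_def csqrt_of_real_nonneg)
qed

theorem theorem4p2:
  fixes a b c d :: real and n :: nat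
  assumes "a > 0" and "b > 0" and "c > 0" and "d > 0"
    and "a * d > b * c"
    and "h a b (x_Delta_plus a b c d) \<in> \<real>"
    and "Re (h a b (x_Delta_plus a b c d)) > 0"
    and "real n \<ge> Re (n_plus a b c d)"
  shows "\<exists>x y :: real. x \<noteq> y \<and> poly (W a b c d n) x = 0 \<and> poly (W a b c d n) y = 0"
proof -
  define s where "s = sqrt (Delta_Delta a b c d)"
  define x where "x = (- (a * b) - 2 * c + 2 * s) / a\<^sup>2"
  define \<alpha> where "\<alpha> = (s - c) / a"
  note real = x_Delta_plus_real[OF assms(1,2,6,7)]
  have xD: "x_Delta_plus a b c d = of_real x"
    unfolding x_def s_def by (rule real(2))
  have s: "s \<ge> 0" "s\<^sup>2 = - (a\<^sup>2 * d) + a * b * c + c\<^sup>2"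
    using real(1) by (auto simp: s_def Delta_Delta_def)
  have "s\<^sup>2 = c\<^sup>2 - a * (a * d - b * c)"
    unfolding s(2) by (simp add: algebra_simps power2_eq_square)
  then have "s\<^sup>2 < c\<^sup>2" using assms by simp
  then have "s < c" using assms by (simp add: power_less_imp_less_base)
  then have \<alpha>: "\<alpha> < 0" using assms by (simp add: \<alpha>_def field_simps)
  have s_eq: "a * \<alpha> + c = s" using assms by (simp add: \<alpha>_def)
  have A: "a * x + b = 2 * \<alpha>"
    using assms by (simp add: x_def \<alpha>_def field_simps power2_eq_square)
  have B: "c * x + d = - \<alpha>\<^sup>2"
  proof -
    have "a\<^sup>2 * x = - (a * b) - 2 * c + 2 * s" using assms by (simp add: x_def)
    with s(2) have "a\<^sup>2 * (c * x + d) = - (s - c)\<^sup>2" by algebra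
    then show ?thesis using assms by (simp add: \<alpha>_def field_simps)
  qed
  have hx: "h a b (of_real x) = of_real (2 * (x - \<alpha>))"
  proof -
    have "(2 - a) * x - b = 2 * (x - \<alpha>)" using A by (simp add: algebra_simps)
    then show ?thesis unfolding h_def by (metis of_real_diff of_real_mult of_real_numeral)
  qed
  have \<eta>: "x - \<alpha> > 0" using assms(7) by (simp add: xD hx)
  have "n_plus a b c d = of_real (- (2 * \<alpha>) / (2 * (x - \<alpha>)))"
    unfolding n_plus_def xD hx A[symmetric] by simp
  then have "real n \<ge> - (2 * \<alpha>) / (2 * (x - \<alpha>))" using assms(8) by simp
  \<comment> \<open>This is the sign of the affine factor in \<open>poly_W_double_root\<close>;
    equality means n = n^+.\<close>
  then have n_ge: "\<alpha> + real n * (x - \<alpha>) \<ge> 0" using \<eta> by (simp add: field_simps)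
  have x0: "x < 0"
  proof -
    have "a * x < 0" using A \<alpha> assms by linarith
    then show ?thesis using assms by (simp add: mult_less_0_iff)
  qed
  have n2: "n \<ge> 2"
  proof (rule ccontr)
    assume "\<not> n \<ge> 2"
    then have "n = 0 \<or> n = 1" by auto
    then show False using n_ge \<alpha> x0 by auto
  qed
  define p where "p = smult ((-1) ^ n) (W a b c d n)"
  have p0: "poly p y = 0 \<longleftrightarrow> poly (W a b c d n) y = 0" for y
    by (simp add: p_def)
  have n_pow: "(-1) ^ n * \<alpha> ^ n > 0"
    using \<alpha> by (simp flip: power_mult_distrib)
  have px: "\<alpha> * poly p x = ((-1) ^ n * \<alpha> ^ n) * (\<alpha> + real n * (x - \<alpha>))"
    unfolding p_def poly_smult mult.left_commute[of \<alpha>] poly_W_double_root[OF A B]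
    by (simp only: mult.assoc)
  obtain z where z: "z < x" "poly p z > 0"
    using poly_W_sign_left[of a b c d x n] assms by (auto simp: p_def)
  have "\<exists>x y. x \<noteq> y \<and> poly p x = 0 \<and> poly p y = 0"
  proof (cases "\<alpha> + real n * (x - \<alpha>) = 0")
    case False
    then have "\<alpha> * poly p x > 0" using n_ge n_pow unfolding px by simp
    then have px_neg: "poly p x < 0" using \<alpha> by (simp add: zero_less_mult_iff)
    define y where "y = - d / c"
    have y: "c * y + d = 0" using assms by (simp add: y_def)
    have "c * x < c * y" using y B \<alpha> by (smt (verit) zero_less_power2)
    then have xy: "x < y" using assms by simp
    \<comment> \<open>Here a d > b c makes A negative at \<open>y\<close>.\<close>
    have "c * (a * y + b) = b * c - a * d"
      using y by algebra
    then have Ay: "a * y + b < 0" using assms by (smt (verit) mult_nonneg_nonneg)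
    have y0: "y < 0" using assms by (simp add: y_def)
    obtain m where m: "n = Suc m" using n2 by (cases n) auto
    have "poly p y = (- (a * y + b)) ^ m * (- y)"
      unfolding p_def m poly_smult poly_W_at_root_of_second_coeff[OF y] power_minus[of "a * y + b"]
      by simp
    then have "poly p y > 0" using Ay y0 by (simp only: zero_less_power mult_pos_pos neg_0_less_iff_less)
    then obtain v where "v > x" "poly p v = 0" using poly_IVT_pos[OF xy px_neg] by blast
    moreover obtain u where "u < x" "poly p u = 0" using poly_IVT_neg[OF z px_neg] by blast
    ultimately show ?thesis by (metis less_asym)
  next
    case True
    then have px_0: "poly p x = 0" using px \<alpha> by simp
    define N where "N = real n"
    have N: "N \<ge> 2" using n2 by (simp add: N_def)
    have eq: "N * (x - \<alpha>) = - \<alpha>" using True by (simp add: N_def)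
    have "\<alpha> ^ 3 * poly (pderiv p) x = ((-1) ^ n * \<alpha> ^ n) *
       (N * \<alpha>\<^sup>2 + N * (N - 1) / 2 * \<alpha> * (a * \<alpha> + c)
         + (x - \<alpha>) * (N * (N - 1) / 2 * \<alpha> * a + N * (N - 1) * (N - 2) / 6 * (a * \<alpha> + c)))"
      using poly_pderiv_W_double_root[OF A B, of n] by (simp add: p_def N_def pderiv_smult)
    \<comment> \<open>One factor \<open>N\<close> is moved next to \<open>x - \<alpha>\<close>, so
      that \<open>eq\<close> can replace the product by \<open>- \<alpha>\<close>.\<close>
    also have "N * \<alpha>\<^sup>2 + N * (N - 1) / 2 * \<alpha> * (a * \<alpha> + c)
         + (x - \<alpha>) * (N * (N - 1) / 2 * \<alpha> * a + N * (N - 1) * (N - 2) / 6 * (a * \<alpha> + c))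
       = N * \<alpha>\<^sup>2 + N * (N - 1) / 2 * \<alpha> * s
         + (N * (x - \<alpha>)) * ((N - 1) / 2 * \<alpha> * a + (N - 1) * (N - 2) / 6 * s)"
      unfolding s_eq by (simp add: algebra_simps)
    also have "\<dots> = \<alpha> * (\<alpha> * (N - (N - 1) / 2 * a) + (N\<^sup>2 - 1) / 3 * s)"
      unfolding eq by (simp add: field_simps power2_eq_square)
    finally have d: "\<alpha> ^ 3 * poly (pderiv p) x = ((-1) ^ n * \<alpha> ^ n) *
       (\<alpha> * (\<alpha> * (N - (N - 1) / 2 * a) + (N\<^sup>2 - 1) / 3 * s))" .
    \<comment> \<open>By \<open>eq\<close>, N x = (N - 1) \<alpha>, and 2 \<alpha> = a x + b. Since
      \<open>x\<close> is negative, this decides the sign of the bracket for every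
      \<open>a\<close>.\<close>
    have "x * (N - (N - 1) / 2 * a) = (N - 1) * b / 2"
      using eq A by algebra
    also have "\<dots> > 0" using N assms by simp
    finally have "N - (N - 1) / 2 * a < 0" using x0 by (simp add: zero_less_mult_iff)
    then have "\<alpha> * (N - (N - 1) / 2 * a) > 0" using \<alpha> by (simp add: mult_neg_neg)
    moreover have "(N\<^sup>2 - 1) / 3 * s \<ge> 0" using N s by simp
    ultimately have "\<alpha> * (\<alpha> * (N - (N - 1) / 2 * a) + (N\<^sup>2 - 1) / 3 * s) < 0"
      using \<alpha> by (simp add: mult_neg_pos)
    then have "\<alpha> ^ 3 * poly (pderiv p) x < 0" unfolding d using n_pow by (rule mult_pos_neg[rotated])
    moreover have "\<alpha> ^ 3 < 0" using \<alpha> by simp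
    ultimately have "poly (pderiv p) x > 0" by (simp add: mult_less_0_iff)
    from DERIV_pos_inc_left[OF poly_DERIV this] obtain e
      where e: "e > 0" "\<And>t. t > 0 \<Longrightarrow> t < e \<Longrightarrow> poly p (x - t) < poly p x" by auto
    \<comment> \<open>Small enough for \<open>p\<close> to be negative at \<open>x - t\<close> and
      for \<open>x - t\<close> to stay to the right of \<open>z\<close>.\<close>
    define t where "t = min (e / 2) ((x - z) / 2)"
    have t: "t > 0" "t < e" "z < x - t" using e(1) z by (auto simp: t_def min_def field_simps)
    have "poly p (x - t) < 0" using e(2)[OF t(1,2)] px_0 by simp
    then obtain u where "u < x - t" "poly p u = 0" using poly_IVT_neg[OF t(3) z(2)] by blast
    then show ?thesis using px_0 t by (metis diff_gt_0_iff_gt less_asym less_irrefl diff_less_eq less_add_same_cancel1 less_trans)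
  qed
  then show ?thesis by (simp add: p0)
qed

end
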